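(* Let $X$ be an unweighted bipartite graph on $n$ vertices admitting local $\epsilon$-uniform mixing at a vertex $u$ relative to the adjacency matrix $A(X)$. Then $n$ or $\deg u$ is even. Moreover, the number of vertices of $X$ whose degree $d$ satisfies $d\equiv 2$ or $3 \pmod 4$ is even if and only if $|E(X)|$ and $\frac12 n\deg u$ have the same parity.
   Context: Graphs are finite, simple, undirected and connected; unweighted means all edges have weight $1$. Put $U(t)=e^{\mathrm{i}tA(X)}$. $\mathbf{e}_u$ is the characteristic vector of $u$, $\mathbf{1}$ the all-ones vector, $\circ$ the entrywise product. Local $\epsilon$-uniform mixing occurs at $u$ relative to $A(X)$ if for each $\epsilon>0$ there is a time $\tau\in\mathbb{R}$ such that $\big\|(U(\tau)\mathbf{e}_u)\circ(\overline{U(\tau)}\mathbf{e}_u)-\tfrac1n\mathbf{1}\big\|<\epsilon$. *)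

theory Defs
  imports "HOL-Analysis.Analysis"
begin

text \<open>
  A finite simple undirected graph has the finite type \<open>'v\<close> as its vertex set and is given by its
  set \<open>E\<close> of edges, each edge being a set of two vertices.
\<close>

definition simple_graph :: "'v::finite set set \<Rightarrow> bool" where
  "simple_graph E \<longleftrightarrow> (\<forall>e\<in>E. card e = 2)"

definition adjacent :: "'v::finite set set \<Rightarrow> 'v \<Rightarrow> 'v \<Rightarrow> bool" where
  "adjacent E u v \<longleftrightarrow> {u, v} \<in> E"

definition graph_connected :: "'v::finite set set \<Rightarrow> bool" where
  "graph_connected E \<longleftrightarrow> (\<forall>u v. (adjacent E)\<^sup>*\<^sup>* u v)"

definition bipartite :: "'v::finite set set \<Rightarrow> bool" where
  "bipartite E \<longleftrightarrow> (\<exists>P Q. P \<union> Q = UNIV \<and> P \<inter> Q = {} \<and>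
     (\<forall>e\<in>E. \<exists>p\<in>P. \<exists>q\<in>Q. e = {p, q}))"

definition vertex_degree :: "'v::finite set set \<Rightarrow> 'v \<Rightarrow> nat" where
  "vertex_degree E u = card {v. adjacent E u v}"

definition adj_matrix :: "'v::finite set set \<Rightarrow> complex^'v^'v" where
  "adj_matrix E = (\<chi> u v. if adjacent E u v then 1 else 0)"

text \<open>
  The library's \<open>*\<close> and \<open>^\<close> on type \<open>vec\<close> are entrywise, so matrix powers are iterated from \<open>**\<close>.
\<close>

definition mat_power :: "complex^'v^'v \<Rightarrow> nat \<Rightarrow> complex^'v^'v" where
  "mat_power A k = ((\<lambda>B. A ** B) ^^ k) (mat 1)"

definition mat_exp :: "complex^'v^'v \<Rightarrow> complex^'v^'v" where
  "mat_exp A = (\<Sum>k. mat_power A k /\<^sub>R fact k)"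

definition mat_scale :: "complex \<Rightarrow> complex^'v^'v \<Rightarrow> complex^'v^'v" where
  "mat_scale c A = (\<chi> i j. c * A $ i $ j)"

definition mat_cnj :: "complex^'v^'v \<Rightarrow> complex^'v^'v" where
  "mat_cnj A = (\<chi> i j. cnj (A $ i $ j))"

definition transition_matrix :: "'v::finite set set \<Rightarrow> real \<Rightarrow> complex^'v^'v" where
  "transition_matrix E t = mat_exp (mat_scale (\<i> * complex_of_real t) (adj_matrix E))"

text \<open>
  Here \<open>axis u 1\<close> is the characteristic vector of \<open>u\<close>, \<open>*\<close> on vectors is the entrywise product, and
  the vector \<open>1\<close> is the all-ones vector.
\<close>

definition local_eps_uniform_mixing :: "'v::finite set set \<Rightarrow> 'v \<Rightarrow> bool" where
  "local_eps_uniform_mixing E u \<longleftrightarrow> (\<forall>\<epsilon>>0. \<exists>\<tau>::real.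
     norm ((transition_matrix E \<tau> *v axis u 1) * (mat_cnj (transition_matrix E \<tau>) *v axis u 1)
           - (1 / of_nat CARD('v)) *s (1 :: complex^'v)) < \<epsilon>)"

lemma norm_mat_power_entry_le:
  fixes A :: "complex^'v^'v"
  shows "norm (mat_power A k $ i $ j) \<le> (\<Sum>a\<in>UNIV. \<Sum>b\<in>UNIV. norm (A $ a $ b)) ^ k"
proof (induction k arbitrary: i j)
  case 0
  show ?case by (simp add: mat_power_def mat_def)
next
  case (Suc k)
  let ?c = "\<Sum>a\<in>UNIV. \<Sum>b\<in>UNIV. norm (A $ a $ b)"
  have row: "(\<Sum>b\<in>UNIV. norm (A $ i $ b)) \<le> ?c"
    by (rule member_le_sum[where f = "\<lambda>a. \<Sum>b\<in>UNIV. norm (A $ a $ b)"]) (auto intro: sum_nonneg)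
  have c0: "0 \<le> ?c" by (intro sum_nonneg) auto
  have "norm (mat_power A (Suc k) $ i $ j) = norm (\<Sum>l\<in>UNIV. A $ i $ l * mat_power A k $ l $ j)"
    by (simp add: mat_power_def matrix_matrix_mult_def)
  also have "\<dots> \<le> (\<Sum>l\<in>UNIV. norm (A $ i $ l) * ?c ^ k)"
    by (rule order_trans[OF norm_sum])
      (intro sum_mono, simp add: norm_mult mult_left_mono Suc.IH)
  also have "\<dots> = (\<Sum>l\<in>UNIV. norm (A $ i $ l)) * ?c ^ k"
    by (simp add: sum_distrib_right)
  also have "\<dots> \<le> ?c * ?c ^ k"
    by (intro mult_right_mono row zero_le_power c0)
  finally show ?case by simp
qed

lemma summable_mat_exp:
  fixes A :: "complex^'v^'v"
  shows "summable (\<lambda>k. mat_power A k /\<^sub>R fact k)"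
proof -
  let ?c = "\<Sum>a\<in>UNIV. \<Sum>b\<in>UNIV. norm (A $ a $ b)"
  let ?n = "real CARD('v)"
  have bound: "norm (mat_power A k) \<le> ?n * (?n * ?c ^ k)" for k
  proof -
    have row: "norm (mat_power A k $ i) \<le> ?n * ?c ^ k" for i
    proof -
      have "norm (mat_power A k $ i) \<le> (\<Sum>j\<in>UNIV. norm (mat_power A k $ i $ j))"
        unfolding norm_vec_def by (rule L2_set_le_sum) simp
      also have "\<dots> \<le> (\<Sum>j\<in>(UNIV :: 'v set). ?c ^ k)"
        by (intro sum_mono norm_mat_power_entry_le)
      finally show ?thesis by simp
    qed
    have "norm (mat_power A k) \<le> (\<Sum>i\<in>UNIV. norm (mat_power A k $ i))"
      unfolding norm_vec_def[of "mat_power A k"] by (rule L2_set_le_sum) simp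
    also have "\<dots> \<le> (\<Sum>i\<in>(UNIV :: 'v set). ?n * ?c ^ k)"
      by (intro sum_mono row)
    finally show ?thesis by simp
  qed
  have "summable (\<lambda>k. (?n * ?n) * (?c ^ k /\<^sub>R fact k))"
    by (intro summable_mult summable_exp_generic)
  then show ?thesis
  proof (rule summable_comparison_test'[where N = 0], goal_cases)
    case (1 k)
    have "norm (mat_power A k /\<^sub>R fact k) = inverse (fact k) * norm (mat_power A k)"
      by simp
    also have "\<dots> \<le> inverse (fact k) * (?n * (?n * ?c ^ k))"
      by (intro mult_left_mono bound) simp
    finally show ?case by (simp add: mult_ac)
  qed
qed

end

theory Submission
  imports Defs
begin

text \<open>
  In a bipartite graph the column \<open>w = U(t) e\<^sub>u\<close> is real on the side of \<open>u\<close> and purely imaginary on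
  the other side, so near-uniform mixing means that \<open>\<surd>n w\<close> is close to a vector of signs \<open>s\<close>, up to
  the factor \<open>\<i>\<close> on the second side. Since \<open>\<parallel>A w\<parallel>\<^sup>2 = \<parallel>A e\<^sub>u\<parallel>\<^sup>2 = deg u\<close> for all times, the integer
  \<open>\<Sum>\<^sub>v (\<Sum>\<^bsub>x \<sim> v\<^esub> s\<^sub>x)\<^sup>2\<close> lies within distance less than 1 of \<open>n deg u\<close>, hence equals it. The inner sum has
  the parity of \<open>d = deg v\<close>, so its square is congruent modulo 4 to \<open>d + 2 [d mod 4 \<in> {2, 3}]\<close>. Summing
  over \<open>v\<close> and using the handshake lemma, \<open>n deg u\<close> is congruent modulo 4 to \<open>2 |E|\<close> plus twice the
  number of vertices with degree 2 or 3 modulo 4.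
\<close>

section \<open>Bipartition signs and the handshake lemma\<close>

lemma adjacent_sym: "adjacent E x y \<longleftrightarrow> adjacent E y x"
  by (simp add: adjacent_def insert_commute)

text \<open>The sign of a vertex records whether it lies on the same side as \<open>u\<close>.
  Comparing with \<open>u\<close> instead of with \<open>P\<close> normalizes \<sigma> at
  \<open>u\<close> to 1, whichever side contains \<open>u\<close>.\<close>

lemma bipartite_sign:
  assumes "bipartite E"
  shows "\<exists>\<sigma> :: 'v::finite \<Rightarrow> int. (\<forall>v. \<sigma> v = 1 \<or> \<sigma> v = -1) \<and>
    (\<forall>x y. adjacent E x y \<longrightarrow> \<sigma> x = - \<sigma> y) \<and> \<sigma> u = 1"
proof -
  from assms obtain P Q where PQ: "P \<union> Q = UNIV" "P \<inter> Q = {}"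
    "\<forall>e\<in>E. \<exists>p\<in>P. \<exists>q\<in>Q. e = {p, q}"
    unfolding bipartite_def by (elim exE conjE)
  let ?\<sigma> = "\<lambda>v. if (v \<in> P) = (u \<in> P) then 1 else - 1 :: int"
  have "?\<sigma> x = - ?\<sigma> y" if xy: "adjacent E x y" for x y
  proof -
    obtain p q where "p \<in> P" "q \<in> Q" "{x, y} = {p, q}"
      using bspec[OF PQ(3) xy[unfolded adjacent_def]] by (elim bexE)
    then show ?thesis using PQ(2) by (auto simp: doubleton_eq_iff)
  qed
  then show ?thesis by (intro exI[of _ ?\<sigma>]) auto
qed

text \<open>Incident pairs of a vertex and an edge are counted in two ways, neighbours of
  \<open>v\<close> being identified with the edges through \<open>v\<close>.\<close>

lemma sum_vertex_degree:
  assumes "simple_graph E"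
  shows "(\<Sum>v\<in>UNIV. vertex_degree E v) = 2 * card E"
proof -
  have deg: "vertex_degree E v = card {e \<in> E. v \<in> e}" for v
  proof -
    have "bij_betw (\<lambda>x. {v, x}) {x. adjacent E v x} {e \<in> E. v \<in> e}"
    proof (rule bij_betw_imageI)
      show "inj_on (\<lambda>x. {v, x}) {x. adjacent E v x}"
        by (auto simp: inj_on_def doubleton_eq_iff)
      show "(\<lambda>x. {v, x}) ` {x. adjacent E v x} = {e \<in> E. v \<in> e}"
      proof
        show "{e \<in> E. v \<in> e} \<subseteq> (\<lambda>x. {v, x}) ` {x. adjacent E v x}"
        proof
          fix e assume e: "e \<in> {e \<in> E. v \<in> e}"
          then have "card e = 2" using assms by (auto simp: simple_graph_def)
          then obtain a b where "e = {a, b}" by (auto simp: card_2_iff)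
          then show "e \<in> (\<lambda>x. {v, x}) ` {x. adjacent E v x}"
            using e by (auto simp: adjacent_def insert_commute)
        qed
      qed (auto simp: adjacent_def)
    qed
    then show ?thesis
      unfolding vertex_degree_def by (rule bij_betw_same_card)
  qed
  have "(\<Sum>v\<in>UNIV. vertex_degree E v) = (\<Sum>v\<in>UNIV. \<Sum>e\<in>E. if v \<in> e then 1 else 0)"
    by (simp add: deg sum.If_cases Int_def)
  also have "\<dots> = (\<Sum>e\<in>E. \<Sum>v\<in>UNIV. if v \<in> e then 1 else 0)"
    by (rule sum.swap)
  also have "\<dots> = (\<Sum>e\<in>E. card e)"
    by (simp add: sum.If_cases)
  also have "\<dots> = (\<Sum>e\<in>E. 2)"
    using assms by (intro sum.cong) (auto simp: simple_graph_def)
  finally show ?thesis by simp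
qed

section \<open>Power series and differential equation of the transition matrix\<close>

lemma mat_power_Suc_nth:
  "mat_power A (Suc k) $ i $ j = (\<Sum>l\<in>UNIV. A $ i $ l * mat_power A k $ l $ j)"
  by (simp add: mat_power_def matrix_matrix_mult_def)

lemma mat_power_scale_nth: "mat_power (mat_scale c A) k $ i $ j = c ^ k * mat_power A k $ i $ j"
proof (induction k arbitrary: i)
  case 0
  show ?case by (simp add: mat_power_def)
next
  case (Suc k)
  then show ?case
    by (simp add: mat_power_Suc_nth mat_scale_def sum_distrib_left mult_ac)
qed

lemma mat_power_adj_Suc_nth:
  "mat_power (adj_matrix E) (Suc k) $ i $ j = (\<Sum>l | adjacent E i l. mat_power (adj_matrix E) k $ l $ j)"
proof -
  have "mat_power (adj_matrix E) (Suc k) $ i $ j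
      = (\<Sum>l\<in>UNIV. if adjacent E i l then mat_power (adj_matrix E) k $ l $ j else 0)"
    unfolding mat_power_Suc_nth by (intro sum.cong) (auto simp: adj_matrix_def)
  then show ?thesis by (simp add: sum.If_cases)
qed

lemma matrix_vector_mult_axis_nth:
  fixes M :: "complex^'v^'v"
  shows "(M *v axis u 1) $ v = M $ v $ u"
proof -
  have "(M *v axis u 1) $ v = (\<Sum>x\<in>UNIV. if x = u then M $ v $ x else 0)"
    unfolding matrix_vector_mult_def vec_lambda_beta by (intro sum.cong) (auto simp: axis_def)
  then show ?thesis by simp
qed

text \<open>The exponential series is read entrywise. Splitting off the power of \<open>t\<close> as
  the last factor puts each entry into the shape of a power series, ready for termwise
  differentiation.\<close>

lemma transition_matrix_sums:
  "(\<lambda>k. mat_power (adj_matrix E) k $ v $ u * \<i> ^ k / fact k * of_real t ^ k)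
     sums (transition_matrix E t $ v $ u)"
proof -
  let ?M = "mat_scale (\<i> * complex_of_real t) (adj_matrix E)"
  have "(\<lambda>k. mat_power ?M k /\<^sub>R fact k) sums transition_matrix E t"
    unfolding transition_matrix_def mat_exp_def
    by (rule summable_sums[OF summable_mat_exp])
  then have "(\<lambda>k. (mat_power ?M k /\<^sub>R fact k) $ v $ u) sums (transition_matrix E t $ v $ u)"
    by (intro bounded_linear.sums[OF bounded_linear_vec_nth])
  moreover have "(mat_power ?M k /\<^sub>R fact k) $ v $ u
      = mat_power (adj_matrix E) k $ v $ u * \<i> ^ k / fact k * of_real t ^ k" for k
    unfolding vector_scaleR_component mat_power_scale_nth
    by (simp add: power_mult_distrib scaleR_conv_of_real field_simps)
  ultimately show ?thesis by simp
qed

lemma transition_matrix_0: "transition_matrix E 0 $ v $ u = (if v = u then 1 else 0)"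
proof -
  have "(\<lambda>k. mat_power (adj_matrix E) k $ v $ u * \<i> ^ k / fact k * 0 ^ k)
      sums (mat_power (adj_matrix E) 0 $ v $ u * \<i> ^ 0 / fact 0)"
    by (rule powser_sums_zero)
  from sums_unique2[OF this transition_matrix_sums[of E v u 0, simplified of_real_0]]
  show ?thesis by (simp add: mat_power_def mat_def)
qed

text \<open>This is U' = iAU, entry by entry: the recursion for powers of A makes the formal
  derivative of the series at \<open>v\<close> equal to i times the sum of the series at the
  neighbours of \<open>v\<close>.\<close>

lemma transition_matrix_has_vector_derivative:
  "((\<lambda>t. transition_matrix E t $ v $ u) has_vector_derivative
     \<i> * (\<Sum>x | adjacent E v x. transition_matrix E t $ x $ u)) (at t)"
proof -
  define a where "a v k = mat_power (adj_matrix E) k $ v $ u * \<i> ^ k / fact k" for v k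
  have sums: "(\<lambda>k. a v k * of_real t ^ k) sums (transition_matrix E t $ v $ u)" for v t
    unfolding a_def by (rule transition_matrix_sums)
  \<comment> \<open>Termwise differentiation needs convergence at every complex point; convergence
    at the real point |z| + 1 gives it inside that radius.\<close>
  have summ: "summable (\<lambda>k. a v k * z ^ k)" for z
  proof (rule powser_inside)
    show "summable (\<lambda>k. a v k * of_real (norm z + 1) ^ k)"
      using sums by (rule sums_summable)
  qed simp
  have diffs: "diffs (a v) k = \<i> * (\<Sum>x | adjacent E v x. a x k)" for k
    unfolding diffs_def a_def mat_power_adj_Suc_nth
    by (simp add: sum_distrib_left sum_distrib_right sum_divide_distrib field_simps
        del: of_nat_Suc)
  have "(\<lambda>k. \<i> * (\<Sum>x | adjacent E v x. a x k * of_real t ^ k)) sums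
      (\<i> * (\<Sum>x | adjacent E v x. transition_matrix E t $ x $ u))"
    by (intro sums_mult sums_sum sums)
  then have "(\<Sum>k. diffs (a v) k * of_real t ^ k) =
      \<i> * (\<Sum>x | adjacent E v x. transition_matrix E t $ x $ u)"
    by (intro sums_unique[symmetric]) (simp add: diffs sum_distrib_right mult.assoc)
  then have "((\<lambda>z. \<Sum>k. a v k * z ^ k) has_field_derivative
      \<i> * (\<Sum>x | adjacent E v x. transition_matrix E t $ x $ u)) (at (of_real t))"
    using termdiffs_strong_converges_everywhere[of "a v" "of_real t", OF summ] by simp
  from has_vector_derivative_real_field[OF this]
  show ?thesis using sums_unique[OF sums[of v]] by simp
qed

text \<open>Conjugation multiplies the k-th term of the series by (-1)^k. Walks of length k from
  \<open>u\<close> reach \<open>v\<close> only if (-1)^k is the sign of \<open>v\<close>, so the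
  same factor \<sigma> \<open>v\<close> comes out of all terms.\<close>

lemma transition_matrix_cnj:
  fixes \<sigma> :: "'v::finite \<Rightarrow> int"
  assumes \<sigma>: "\<And>x y. adjacent E x y \<Longrightarrow> \<sigma> x = - \<sigma> y" "\<sigma> u = 1"
  shows "cnj (transition_matrix E t $ v $ u) = of_int (\<sigma> v) * transition_matrix E t $ v $ u"
proof -
  let ?A = "adj_matrix E"
  have real: "cnj (mat_power ?A k $ v $ u) = mat_power ?A k $ v $ u" for k v
    by (induction k arbitrary: v) (simp_all add: mat_power_adj_Suc_nth, simp add: mat_power_def mat_def)
  \<comment> \<open>Equivalent to the vanishing of the entry unless (-1)^k is the sign of
    \<open>v\<close>, but in a form that passes through the induction without cases.\<close>
  have parity: "of_int (\<sigma> v) * mat_power ?A k $ v $ u = (- 1) ^ k * mat_power ?A k $ v $ u" for k v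
  proof (induction k arbitrary: v)
    case 0
    show ?case by (simp add: mat_power_def mat_def \<sigma>)
  next
    case (Suc k)
    have "of_int (\<sigma> v) * mat_power ?A k $ x $ u = - ((- 1) ^ k * mat_power ?A k $ x $ u)"
      if "adjacent E v x" for x
      using Suc[of x] \<sigma>(1)[OF that] by simp
    then show ?case
      by (simp add: mat_power_adj_Suc_nth sum_distrib_left flip: sum_negf)
  qed
  have "(\<lambda>k. cnj (mat_power ?A k $ v $ u * \<i> ^ k / fact k * of_real t ^ k))
      sums cnj (transition_matrix E t $ v $ u)"
    using transition_matrix_sums by (simp only: sums_cnj)
  moreover have "cnj (mat_power ?A k $ v $ u * \<i> ^ k / fact k * of_real t ^ k)
      = of_int (\<sigma> v) * (mat_power ?A k $ v $ u * \<i> ^ k / fact k * of_real t ^ k)" for k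
  proof -
    have "cnj (mat_power ?A k $ v $ u * \<i> ^ k / fact k * of_real t ^ k)
        = ((- 1) ^ k * mat_power ?A k $ v $ u) * \<i> ^ k / fact k * of_real t ^ k"
      by (simp add: real power_minus[of \<i>] mult_ac)
    then show ?thesis by (simp add: parity[symmetric] mult_ac)
  qed
  ultimately have "(\<lambda>k. of_int (\<sigma> v) * (mat_power ?A k $ v $ u * \<i> ^ k / fact k * of_real t ^ k))
      sums cnj (transition_matrix E t $ v $ u)" by (simp only:)
  from sums_unique2[OF this sums_mult[OF transition_matrix_sums]] show ?thesis .
qed

text \<open>Writing d = 4k + r and f = 2g + r gives f^2 = r^2 modulo 4, and r^2 - r is 0 modulo 4
  for r = 0, 1 but 2 modulo 4 for r = 2, 3.\<close>

lemma signed_degree_square_cong: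
  fixes f :: int
  assumes "even (f - int d)"
  shows "f\<^sup>2 mod 4 = (int d + 2 * of_bool (d mod 4 = 2 \<or> d mod 4 = 3)) mod 4"
proof -
  define k r where "k = d div 4" and "r = d mod 4"
  have d: "d = 4 * k + r" by (simp add: k_def r_def)
  have "r < 4" by (simp add: r_def)
  then have r: "r = 0 \<or> r = 1 \<or> r = 2 \<or> r = 3" by linarith
  obtain m where "f - int d = 2 * m" using assms by (rule dvdE)
  then have f: "f = 4 * int k + int r + 2 * m" by (simp add: d)
  define g where "g = 2 * int k + m"
  have fg: "f = 2 * g + int r" by (simp add: f g_def)
  have "4 dvd f\<^sup>2 - (int d + 2 * of_bool (r = 2 \<or> r = 3))"
    using r
  proof (elim disjE)
    assume "r = 0"
    then have "f\<^sup>2 - (int d + 2 * of_bool (r = 2 \<or> r = 3)) = 4 * (g\<^sup>2 - int k)"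
      by (simp add: fg d power2_eq_square algebra_simps)
    then show ?thesis by simp
  next
    assume "r = 1"
    then have "f\<^sup>2 - (int d + 2 * of_bool (r = 2 \<or> r = 3)) = 4 * (g\<^sup>2 + g - int k)"
      by (simp add: fg d power2_eq_square algebra_simps)
    then show ?thesis by simp
  next
    assume "r = 2"
    then have "f\<^sup>2 - (int d + 2 * of_bool (r = 2 \<or> r = 3)) = 4 * (g\<^sup>2 + 2 * g - int k)"
      by (simp add: fg d power2_eq_square algebra_simps)
    then show ?thesis by simp
  next
    assume "r = 3"
    then have "f\<^sup>2 - (int d + 2 * of_bool (r = 2 \<or> r = 3)) = 4 * (g\<^sup>2 + 3 * g + 1 - int k)"
      by (simp add: fg d power2_eq_square algebra_simps)
    then show ?thesis by simp
  qed
  then show ?thesis unfolding mod_eq_dvd_iff r_def .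
qed

section \<open>Real amplitudes and a conserved energy\<close>

text \<open>The amplitudes solve the real system c' = -\<sigma> A c. The energy is the squared norm
  of y = A c; its derivative is a multiple of a sum over adjacent pairs that changes sign when the
  endpoints are exchanged.\<close>

lemma real_amplitudes:
  assumes "bipartite E"
  obtains c :: "real \<Rightarrow> 'v::finite \<Rightarrow> real"
  where "\<And>t v. transition_matrix E t $ v $ u * cnj (transition_matrix E t $ v $ u) = of_real ((c t v)\<^sup>2)"
    and "\<And>t. (\<Sum>v\<in>UNIV. (\<Sum>x | adjacent E v x. c t x)\<^sup>2) = real (vertex_degree E u)"
proof -
  obtain \<sigma> :: "'v \<Rightarrow> int" where "\<forall>v. \<sigma> v = 1 \<or> \<sigma> v = -1"
    "\<forall>x y. adjacent E x y \<longrightarrow> \<sigma> x = - \<sigma> y" "\<sigma> u = 1"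
    using bipartite_sign[OF assms, where u = u] by (elim exE conjE)
  note \<sigma> = this[rule_format]
  define w where "w t v = transition_matrix E t $ v $ u" for t v
  \<comment> \<open>The other of the two parts vanishes, by the conjugation rule.\<close>
  define c where "c t v = (if \<sigma> v = 1 then Re (w t v) else Im (w t v))" for t v
  define y where "y t v = (\<Sum>x | adjacent E v x. c t x)" for t v
  have cnj: "cnj (w t v) = of_int (\<sigma> v) * w t v" for t v
    unfolding w_def by (rule transition_matrix_cnj[where \<sigma> = \<sigma>, OF \<sigma>(2,3)])
  have w: "w t v = (if \<sigma> v = 1 then of_real (c t v) else \<i> * of_real (c t v))" for t v
    using cnj[of t v] \<sigma>(1)[of v] by (auto simp: c_def complex_eq_iff)
  have sq: "w t v * cnj (w t v) = of_real ((c t v)\<^sup>2)" for t v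
    by (auto simp: w power2_eq_square complex_eq_iff)
  have dw: "((\<lambda>t. w t v) has_vector_derivative \<i> * (\<Sum>x | adjacent E v x. w t x)) (at t)" for v t
    unfolding w_def by (rule transition_matrix_has_vector_derivative)
  \<comment> \<open>All neighbours of \<open>v\<close> lie on the opposite side, so their entries
    are all imaginary or all real, and their sum is determined by \<open>y t v\<close>.\<close>
  have dc: "((\<lambda>t. c t v) has_real_derivative - of_int (\<sigma> v) * y t v) (at t)" for v t
  proof (cases "\<sigma> v = 1")
    case True
    then have "\<sigma> x = -1" if "adjacent E v x" for x using \<sigma>(2)[OF that] by simp
    then have "(\<Sum>x | adjacent E v x. w t x) = \<i> * of_real (y t v)"
      by (simp add: w y_def sum_distrib_left)
    with bounded_linear.has_vector_derivative[OF bounded_linear_Re dw[of v t]] True show ?thesis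
      by (simp add: c_def has_real_derivative_iff_has_vector_derivative)
  next
    case False
    then have m: "\<sigma> v = -1" using \<sigma>(1) by blast
    then have "\<sigma> x = 1" if "adjacent E v x" for x using \<sigma>(2)[OF that] by simp
    then have "(\<Sum>x | adjacent E v x. w t x) = of_real (y t v)"
      by (simp add: w y_def)
    with bounded_linear.has_vector_derivative[OF bounded_linear_Im dw[of v t]] m show ?thesis
      by (simp add: c_def has_real_derivative_iff_has_vector_derivative)
  qed
  have const: "((\<lambda>t. \<Sum>v\<in>UNIV. (y t v)\<^sup>2) has_real_derivative 0) (at t)" for t
  proof -
    \<comment> \<open>The energy has derivative -2 S. Exchanging the endpoints keeps the product of
      the \<open>y\<close> values and flips the sign factor, whence S = -S.\<close>
    define S where "S = (\<Sum>v\<in>UNIV. \<Sum>x\<in>UNIV. if adjacent E v x then of_int (\<sigma> x) * y t v * y t x else 0)"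
    have "S = (\<Sum>x\<in>UNIV. \<Sum>v\<in>UNIV. if adjacent E v x then of_int (\<sigma> x) * y t v * y t x else 0)"
      unfolding S_def by (rule sum.swap)
    also have "\<dots> = (\<Sum>x\<in>UNIV. \<Sum>v\<in>UNIV. - (if adjacent E x v then of_int (\<sigma> v) * y t x * y t v else 0))"
    proof (intro sum.cong refl)
      fix x v
      show "(if adjacent E v x then of_int (\<sigma> x) * y t v * y t x else 0)
         = - (if adjacent E x v then of_int (\<sigma> v) * y t x * y t v else 0)"
        using \<sigma>(2)[of x v] by (auto simp: adjacent_sym[of E v x])
    qed
    also have "\<dots> = - S" by (simp add: S_def sum_negf)
    finally have "S = 0" by simp
    have "((\<lambda>t. \<Sum>v\<in>UNIV. (y t v)\<^sup>2) has_real_derivative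
        (\<Sum>v\<in>UNIV. 2 * y t v * (\<Sum>x | adjacent E v x. - of_int (\<sigma> x) * y t x))) (at t)"
      unfolding y_def[of _ v for v]
      by (auto intro!: derivative_eq_intros dc[unfolded y_def] sum.cong)
    also have "(\<Sum>v\<in>UNIV. 2 * y t v * (\<Sum>x | adjacent E v x. - of_int (\<sigma> x) * y t x)) = - 2 * S"
      unfolding S_def
      by (simp add: sum.If_cases sum_distrib_left sum_negf mult_ac)
    finally show ?thesis using \<open>S = 0\<close> by simp
  qed
  have c0: "c 0 v = (if v = u then 1 else 0)" for v
    using \<sigma>(3) by (simp add: c_def w_def transition_matrix_0)
  have y0: "y 0 v = (if adjacent E u v then 1 else 0)" for v
    by (simp add: y_def c0 adjacent_sym[of E u])
  have "(\<Sum>v\<in>UNIV. (y t v)\<^sup>2) = (\<Sum>v\<in>UNIV. (y 0 v)\<^sup>2)" for t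
    by (rule DERIV_isconst_all) (use const in blast)
  also have "(\<Sum>v\<in>UNIV. (y 0 v)\<^sup>2) = real (vertex_degree E u)"
    by (simp add: y0 vertex_degree_def if_distrib[of "\<lambda>x. x\<^sup>2"] sum.If_cases)
  finally show ?thesis using that[of c] sq unfolding w_def y_def by blast
qed

section \<open>From approximate mixing to an exact sign identity\<close>

text \<open>The factor |c| + 1 of |c^2 - 1| is at least 1, so |c| is at least as close to 1 as c^2
  is; the sign is that of c.\<close>

lemma sign_approximation:
  fixes c :: real
  assumes "\<bar>c\<^sup>2 - 1\<bar> < \<delta>"
  obtains s :: int where "s = 1 \<or> s = -1" "\<bar>c - of_int s\<bar> < \<delta>"
proof -
  have "\<bar>\<bar>c\<bar> - 1\<bar> * 1 \<le> \<bar>\<bar>c\<bar> - 1\<bar> * (\<bar>c\<bar> + 1)"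
    by (rule mult_left_mono) auto
  also have "\<dots> = \<bar>(\<bar>c\<bar> - 1) * (\<bar>c\<bar> + 1)\<bar>"
    by (simp add: abs_mult)
  also have "(\<bar>c\<bar> - 1) * (\<bar>c\<bar> + 1) = c\<^sup>2 - 1"
    by (simp add: algebra_simps power2_eq_square)
  finally have "\<bar>\<bar>c\<bar> - 1\<bar> < \<delta>" using assms by simp
  then show ?thesis using that[of 1] that[of "-1"] by (cases "c \<ge> 0") auto
qed

text \<open>Each difference of squares factors into a sum of differences, at most n \<delta>, and a
  sum of terms \<open>b x + s x\<close>, at most 3n; there are n of them.\<close>

lemma sum_square_perturbation:
  fixes b :: "'v::finite \<Rightarrow> real" and s :: "'v \<Rightarrow> real" and N :: "'v \<Rightarrow> 'v set"
  assumes "\<And>x. \<bar>b x - s x\<bar> \<le> \<delta>" "\<And>x. \<bar>s x\<bar> \<le> 1" "\<delta> \<le> 1"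
  shows "\<bar>(\<Sum>v\<in>UNIV. (\<Sum>x\<in>N v. b x)\<^sup>2) - (\<Sum>v\<in>UNIV. (\<Sum>x\<in>N v. s x)\<^sup>2)\<bar>
    \<le> 3 * real CARD('v) ^ 3 * \<delta>"
proof -
  let ?n = "real CARD('v)"
  \<comment> \<open>Here \<open>undefined\<close> is just some vertex at which to use the first
    assumption.\<close>
  have \<delta>0: "0 \<le> \<delta>" using assms(1)[of undefined] by linarith
  have bound: "\<bar>\<Sum>x\<in>N v. g x\<bar> \<le> ?n * C" if "\<And>x. \<bar>g x\<bar> \<le> C" "0 \<le> C" for g C v
  proof -
    have "\<bar>\<Sum>x\<in>N v. g x\<bar> \<le> (\<Sum>x\<in>N v. C)"
      by (rule order_trans[OF sum_abs sum_mono]) (rule that)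
    also have "\<dots> \<le> ?n * C"
      using that(2) by (simp add: mult_right_mono card_mono)
    finally show ?thesis .
  qed
  have "\<bar>(\<Sum>x\<in>N v. b x)\<^sup>2 - (\<Sum>x\<in>N v. s x)\<^sup>2\<bar> \<le> (?n * \<delta>) * (?n * 3)" for v
  proof -
    have "(\<Sum>x\<in>N v. b x)\<^sup>2 - (\<Sum>x\<in>N v. s x)\<^sup>2 = (\<Sum>x\<in>N v. b x - s x) * (\<Sum>x\<in>N v. b x + s x)"
      by (simp add: sum_subtractf sum.distrib power2_eq_square algebra_simps)
    moreover have "\<bar>\<Sum>x\<in>N v. b x - s x\<bar> \<le> ?n * \<delta>"
      by (rule bound) (use assms(1) \<delta>0 in auto)
    moreover have "\<bar>\<Sum>x\<in>N v. b x + s x\<bar> \<le> ?n * 3"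
    proof (rule bound)
      show "\<bar>b x + s x\<bar> \<le> 3" for x
        using assms(1)[of x] assms(2)[of x] assms(3) by linarith
    qed simp
    ultimately show ?thesis
      by (simp only: abs_mult) (intro mult_mono; simp add: \<delta>0)
  qed
  then have "(\<Sum>v\<in>(UNIV :: 'v set). \<bar>(\<Sum>x\<in>N v. b x)\<^sup>2 - (\<Sum>x\<in>N v. s x)\<^sup>2\<bar>)
      \<le> (\<Sum>v\<in>(UNIV :: 'v set). (?n * \<delta>) * (?n * 3))"
    by (intro sum_mono)
  also have "\<dots> = 3 * ?n ^ 3 * \<delta>"
    by (simp add: power3_eq_cube)
  finally show ?thesis
    unfolding sum_subtractf[symmetric] by (rule order_trans[OF sum_abs])
qed

text \<open>All the analysis ends here: one mixing time with a small enough tolerance yields an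
  exact identity between integers.\<close>

lemma local_mixing_sign_vector:
  fixes E :: "'v::finite set set"
  assumes "bipartite E" "local_eps_uniform_mixing E u"
  obtains s :: "'v \<Rightarrow> int"
  where "\<And>v. s v = 1 \<or> s v = -1"
    and "(\<Sum>v\<in>UNIV. (\<Sum>x | adjacent E v x. s x)\<^sup>2) = int (CARD('v) * vertex_degree E u)"
proof -
  let ?n = "real CARD('v)"
  have n: "?n \<ge> 1" by (simp add: Suc_leI)
  obtain c :: "real \<Rightarrow> 'v \<Rightarrow> real" where
    c: "\<And>t v. transition_matrix E t $ v $ u * cnj (transition_matrix E t $ v $ u) = of_real ((c t v)\<^sup>2)"
    and energy: "\<And>t. (\<Sum>v\<in>UNIV. (\<Sum>x | adjacent E v x. c t x)\<^sup>2) = real (vertex_degree E u)"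
    using real_amplitudes[OF assms(1), where u = u] by blast
  \<comment> \<open>This makes the perturbation bound 3 n^3 \<delta> equal to 3/4.\<close>
  define \<delta> where "\<delta> = 1 / (4 * ?n ^ 3)"
  have n3: "1 \<le> ?n ^ 3" using n by (rule one_le_power)
  have \<delta>: "0 < \<delta>" "\<delta> \<le> 1" "3 * ?n ^ 3 * \<delta> < 1"
    unfolding \<delta>_def using n n3 by (simp_all, linarith)
  \<comment> \<open>The tolerance is divided by n because rescaling the amplitudes by the square
    root of n multiplies the error in their squares by n.\<close>
  then have "\<delta> / ?n > 0" using n by simp
  then obtain \<tau> where \<tau>: "norm ((transition_matrix E \<tau> *v axis u 1)
        * (mat_cnj (transition_matrix E \<tau>) *v axis u 1)
      - (1 / of_nat CARD('v)) *s (1 :: complex^'v)) < \<delta> / ?n"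
    using assms(2) unfolding local_eps_uniform_mixing_def by blast
  have near: "\<bar>(c \<tau> v)\<^sup>2 - 1 / ?n\<bar> < \<delta> / ?n" for v
  proof -
    have "((transition_matrix E \<tau> *v axis u 1) * (mat_cnj (transition_matrix E \<tau>) *v axis u 1)
        - (1 / of_nat CARD('v)) *s (1 :: complex^'v)) $ v = of_real ((c \<tau> v)\<^sup>2 - 1 / ?n)"
      by (simp add: matrix_vector_mult_axis_nth mat_cnj_def c)
    then show ?thesis
      using le_less_trans[OF Finite_Cartesian_Product.norm_nth_le \<tau>, of v]
      by (simp only: norm_of_real)
  qed
  define b where "b v = sqrt ?n * c \<tau> v" for v
  have "\<bar>(b v)\<^sup>2 - 1\<bar> < \<delta>" for v
  proof -
    have "(b v)\<^sup>2 - 1 = ?n * ((c \<tau> v)\<^sup>2 - 1 / ?n)"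
      using n by (simp add: b_def power_mult_distrib algebra_simps)
    then show ?thesis using near[of v] n by (simp add: abs_mult field_simps)
  qed
  then have "\<forall>v. \<exists>s::int. (s = 1 \<or> s = -1) \<and> \<bar>b v - of_int s\<bar> < \<delta>"
    using sign_approximation by metis
  then obtain s :: "'v \<Rightarrow> int"
    where s: "\<And>v. s v = 1 \<or> s v = -1" "\<And>v. \<bar>b v - of_int (s v)\<bar> < \<delta>"
    by metis
  let ?S = "\<Sum>v\<in>UNIV. (\<Sum>x | adjacent E v x. s x)\<^sup>2"
  have "(\<Sum>v\<in>UNIV. (\<Sum>x | adjacent E v x. b x)\<^sup>2)
      = ?n * (\<Sum>v\<in>UNIV. (\<Sum>x | adjacent E v x. c \<tau> x)\<^sup>2)"
    by (simp add: b_def sum_distrib_left[symmetric] power_mult_distrib)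
  then have b: "(\<Sum>v\<in>UNIV. (\<Sum>x | adjacent E v x. b x)\<^sup>2) = ?n * real (vertex_degree E u)"
    by (simp add: energy)
  have "\<bar>(\<Sum>v\<in>UNIV. (\<Sum>x | adjacent E v x. b x)\<^sup>2)
      - (\<Sum>v\<in>UNIV. (\<Sum>x | adjacent E v x. real_of_int (s x))\<^sup>2)\<bar> \<le> 3 * ?n ^ 3 * \<delta>"
  proof (rule sum_square_perturbation)
    show "\<bar>b x - of_int (s x)\<bar> \<le> \<delta>" for x using s(2)[of x] by simp
    show "\<bar>real_of_int (s x)\<bar> \<le> 1" for x using s(1)[of x] by auto
  qed (rule \<delta>)
  then have "\<bar>real_of_int (int (CARD('v) * vertex_degree E u) - ?S)\<bar> < 1"
    using \<delta>(3) by (simp add: b)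
  then have "\<bar>int (CARD('v) * vertex_degree E u) - ?S\<bar> < 1"
    by linarith
  then have "?S = int (CARD('v) * vertex_degree E u)" by linarith
  with s(1) show ?thesis by (rule that)
qed

section \<open>Counting modulo 4\<close>

theorem corollary20:
  fixes E :: "'v::finite set set" and u :: 'v
  assumes "simple_graph E"
    and "graph_connected E"
    and "bipartite E"
    and "local_eps_uniform_mixing E u"
  shows "(even CARD('v) \<or> even (vertex_degree E u)) \<and>
    (even (card {v. vertex_degree E v mod 4 = 2 \<or> vertex_degree E v mod 4 = 3}) \<longleftrightarrow>
     (even (card E) \<longleftrightarrow> even (CARD('v) * vertex_degree E u div 2)))"
proof -
  let ?D = "{v. vertex_degree E v mod 4 = 2 \<or> vertex_degree E v mod 4 = 3}"
  obtain s :: "'v \<Rightarrow> int" where s: "\<And>v. s v = 1 \<or> s v = -1"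
    and S: "(\<Sum>v\<in>UNIV. (\<Sum>x | adjacent E v x. s x)\<^sup>2) = int (CARD('v) * vertex_degree E u)"
    using local_mixing_sign_vector[OF assms(3,4)] by blast
  \<comment> \<open>Every sign is odd, so a sum of signs has the parity of its number of
    terms.\<close>
  have "even ((\<Sum>x | adjacent E v x. s x) - int (vertex_degree E v))" for v
  proof -
    have "(\<Sum>x | adjacent E v x. s x) - int (vertex_degree E v) = (\<Sum>x | adjacent E v x. s x - 1)"
      by (simp add: vertex_degree_def sum_subtractf)
    moreover have "even (s x - 1)" for x using s[of x] by auto
    ultimately show ?thesis by (simp add: dvd_sum)
  qed
  then have "(\<Sum>x | adjacent E v x. s x)\<^sup>2 mod 4
      = (int (vertex_degree E v) + 2 * of_bool (v \<in> ?D)) mod 4" for v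
    by (simp add: signed_degree_square_cong)
  then have "(\<Sum>v\<in>UNIV. (\<Sum>x | adjacent E v x. s x)\<^sup>2) mod 4
      = (\<Sum>v\<in>UNIV. int (vertex_degree E v) + 2 * of_bool (v \<in> ?D)) mod 4"
    by (metis (no_types, lifting) mod_sum_eq sum.cong)
  also have "(\<Sum>v\<in>UNIV. int (vertex_degree E v) + 2 * of_bool (v \<in> ?D))
      = int (\<Sum>v\<in>UNIV. vertex_degree E v) + 2 * (\<Sum>v\<in>UNIV. of_bool (v \<in> ?D))"
    by (simp add: sum.distrib sum_distrib_left)
  also have "(\<Sum>v\<in>UNIV. of_bool (v \<in> ?D)) = int (card ?D)"
    by (simp add: of_bool_def sum.If_cases)
  finally have key: "int (CARD('v) * vertex_degree E u) mod 4
      = (2 * int (card E) + 2 * int (card ?D)) mod 4"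
    by (simp only: S sum_vertex_degree[OF assms(1)]) simp
  \<comment> \<open>With the product hidden behind \<open>p\<close>, linear arithmetic suffices: p =
    2(q + r) modulo 4 says that p is even, which is the first claim, and that p/2 has the parity of
    q + r, which is the second.\<close>
  define p q r where "p = CARD('v) * vertex_degree E u" and "q = card E" and "r = card ?D"
  have "int p mod 4 = (2 * int q + 2 * int r) mod 4"
    using key by (simp only: p_def q_def r_def)
  then have "even p \<and> (even r \<longleftrightarrow> (even q \<longleftrightarrow> even (p div 2)))"
    by presburger
  then show ?thesis unfolding p_def q_def r_def by simp
qed

end
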